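(* Let $1\le r<\infty$, let $(X_i)_i$ be a (finite or countable) family of independent real random variables on a probability space, let $\kappa>0$, and let $(W_i)_i$ be $[0,1]$-valued random variables on the same probability space satisfying $\mathbb{E}(W_i\mid X_i)\ge\kappa$ almost surely for all $i$. Then $$\mathbb{E}\Big(\sum_i |W_iX_i|^r\Big)^{\frac1r}\ \ge\ \frac12\,\kappa^r\,\inf_{X_i=Y_i+Z_i}\left[\Big(\sum_i\mathbb{E}|Y_i|^r\Big)^{\frac1r}+\sum_i\mathbb{E}|Z_i|\right],$$ where the infimum is over all families of random variables $(Y_i)_i,(Z_i)_i$ with $X_i=Y_i+Z_i$ for all $i$.
   Context: The weights $W_i$ are not assumed independent of each other or of the $X_j$'s. $\mathbb{E}(\sum\cdots)^{1/r}$ means the expectation of the $r$-th root. $\mathbb{E}(\cdot\mid X_i)$ is conditional expectation with respect to the sigma-algebra generated by $X_i$. *)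

theory Defs
  imports "HOL-Probability.Probability"
begin

text \<open>
  Nonnegative sums and expectations are taken in \<^typ>\<open>ennreal\<close>, since no moment is assumed to be
  finite. The library has no real power on this type; the definition below is meant for \<open>p > 0\<close>.
\<close>

definition enn_powr :: "ennreal \<Rightarrow> real \<Rightarrow> ennreal" where
  "enn_powr x p = (if x = \<infinity> then \<infinity> else ennreal (enn2real x powr p))"

definition decompositions ::
    "'a measure \<Rightarrow> 'i set \<Rightarrow> ('i \<Rightarrow> 'a \<Rightarrow> real) \<Rightarrow> (('i \<Rightarrow> 'a \<Rightarrow> real) \<times> ('i \<Rightarrow> 'a \<Rightarrow> real)) set" where
  "decompositions M I X = {(Y, Z).
     \<forall>i\<in>I. Y i \<in> borel_measurable M \<and> Z i \<in> borel_measurable M \<and>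
           (\<forall>\<omega>\<in>space M. X i \<omega> = Y i \<omega> + Z i \<omega>)}"

end

theory Submission
  imports Defs
begin

text \<open>
  The lower bound on the expected \<open>\<ell>\<^sup>r\<close> norm comes from linearising it with test functions, and the
  optimal test functions also say where to cut the variables.

  Put \<open>a = 1 - 1 / r\<close> and let \<open>h\<^sub>i(X\<^sub>i) \<in> [0, 1]\<close> with \<open>\<Sum>\<^sub>i E h\<^sub>i(X\<^sub>i) \<le> 1\<close>. By Hoelder the norm of
  \<open>(W\<^sub>i X\<^sub>i)\<^sub>i\<close> is at least \<open>\<Sum>\<^sub>i W\<^sub>i \<bar>X\<^sub>i\<bar> h\<^sub>i(X\<^sub>i)\<^sup>a H\<^sup>-\<^sup>a\<close>, where \<open>H = \<Sum>\<^sub>j h\<^sub>j(X\<^sub>j)\<close>. In the summand of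
  index \<open>i\<close>, the random quantity \<open>H\<close> is at most \<open>D\<^sub>i = 1 + \<Sum>\<^sub>j\<^sub>\<noteq>\<^sub>i h\<^sub>j(X\<^sub>j)\<close>, which is independent of \<open>X\<^sub>i\<close> and
  has mean at most 2. The weight \<open>W\<^sub>i\<close> may be correlated with \<open>D\<^sub>i\<close>, but \<open>x \<mapsto> x\<^sup>-\<^sup>a\<close> lies above its tangent
  at \<open>2 / \<kappa>\<close>, and the tangent is affine: its constant part only needs \<open>E(W\<^sub>i | X\<^sub>i) \<ge> \<kappa>\<close>, and in its
  decreasing part \<open>W\<^sub>i\<close> may be replaced by 1. The outcome is
  \<open>E(W\<^sub>i D\<^sub>i\<^sup>-\<^sup>a | X\<^sub>i) \<ge> \<kappa> (2 / \<kappa>)\<^sup>-\<^sup>a \<ge> \<kappa>\<^sup>r / 2\<close>, and so \<open>\<kappa>\<^sup>r / 2\<close> times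
  \<open>\<Sum>\<^sub>i E \<bar>X\<^sub>i\<bar> h\<^sub>i(X\<^sub>i)\<^sup>a\<close> is a lower bound (\<open>test_function_lower_bound\<close>).

  Take \<open>h\<^sub>i(x) = (min \<bar>x\<bar> t / t)\<^sup>r\<close> and let \<open>\<Phi>(t) = \<Sum>\<^sub>i E (min \<bar>X\<^sub>i\<bar> t)\<^sup>r\<close>. The constraint on \<open>h\<close> reads
  \<open>\<Phi>(t) \<le> t\<^sup>r\<close>, and then
  \<open>\<Sum>\<^sub>i E \<bar>X\<^sub>i\<bar> h\<^sub>i(X\<^sub>i)\<^sup>a = t\<^sup>1\<^sup>-\<^sup>r \<Phi>(t) + \<Sum>\<^sub>i E max (\<bar>X\<^sub>i\<bar> - t) 0\<close>. Truncating \<open>X\<^sub>i\<close> to \<open>[-t, t]\<close> gives a decomposition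
  of cost \<open>\<Phi>(t)\<^sup>1\<^sup>/\<^sup>r + \<Sum>\<^sub>i E max (\<bar>X\<^sub>i\<bar> - t) 0\<close>. The two expressions agree when \<open>\<Phi>(t) = t\<^sup>r\<close>, which happens at
  the infimum of all admissible levels \<open>t\<close> if that is positive. If it is 0, the two differ by at most
  \<open>t\<close> for arbitrarily small \<open>t\<close>; if no level is admissible, normalised test functions show that the
  left-hand side is infinite.
\<close>

section \<open>Inequalities for real numbers\<close>

text \<open>
  The convex function \<open>x \<mapsto> x\<^sup>-\<^sup>a\<close> lies above its tangent at \<open>c\<close>; equivalently, \<open>e\<^sup>y \<ge> 1 + y\<close> at
  \<open>y = - a ln (x / c)\<close>.
\<close>

lemma powr_neg_tangent:
  fixes a c x :: real
  assumes "0 \<le> a" "0 < c" "0 < x"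
  shows "c powr -a * (1 + a - a * (x / c)) \<le> x powr -a"
proof -
  have "1 + a - a * (x / c) \<le> 1 + (- a) * ln (x / c)"
    using mult_left_mono[OF ln_le_minus_one[of "x / c"], of a] assms by (simp add: algebra_simps)
  also have "\<dots> \<le> exp ((- a) * ln (x / c))"
    by (rule exp_ge_add_one_self)
  also have "\<dots> = x powr -a / c powr -a"
    using assms by (simp add: powr_def ln_div exp_diff[symmetric] algebra_simps)
  finally show ?thesis
    using assms by (simp add: field_simps)
qed

text \<open>
  Hoelder's inequality with exponents \<open>1 / a\<close> and \<open>1 / b\<close>, from Young's inequality after both sums are
  normalised to 1. Writing the exponents as \<open>a\<close> and \<open>b\<close> includes the endpoint \<open>a = 1\<close>, so that \<open>r = 1\<close>
  needs no separate treatment.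
\<close>

lemma Holder_sum:
  fixes u v :: "'i \<Rightarrow> real"
  assumes u: "\<And>i. i \<in> F \<Longrightarrow> 0 \<le> u i" and v: "\<And>i. i \<in> F \<Longrightarrow> 0 \<le> v i"
    and F: "finite F" and ab: "0 \<le> a" "0 \<le> b" "a + b = 1"
  shows "(\<Sum>i\<in>F. u i powr a * v i powr b) \<le> (\<Sum>i\<in>F. u i) powr a * (\<Sum>i\<in>F. v i) powr b"
proof (cases "(\<Sum>i\<in>F. u i) = 0 \<or> (\<Sum>i\<in>F. v i) = 0")
  case True
  then have "(\<forall>i\<in>F. u i = 0) \<or> (\<forall>i\<in>F. v i = 0)"
    using u v F by (simp add: sum_nonneg_eq_0_iff)
  then have "(\<Sum>i\<in>F. u i powr a * v i powr b) = 0"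
    by (intro sum.neutral) auto
  then show ?thesis
    by simp
next
  case False
  define U V where "U = (\<Sum>i\<in>F. u i)" and "V = (\<Sum>i\<in>F. v i)"
  have pos: "0 < U" "0 < V"
    using False u v by (simp_all add: U_def V_def sum_nonneg order_less_le)
  have "(\<Sum>i\<in>F. u i powr a * v i powr b) = U powr a * V powr b * (\<Sum>i\<in>F. (u i / U) powr a * (v i / V) powr b)"
    unfolding sum_distrib_left using pos u v by (intro sum.cong) (auto simp: powr_divide)
  also have "(\<Sum>i\<in>F. (u i / U) powr a * (v i / V) powr b) \<le> (\<Sum>i\<in>F. a * (u i / U) + b * (v i / V))"
  proof (rule sum_mono)
    fix i assume i: "i \<in> F"
    show "(u i / U) powr a * (v i / V) powr b \<le> a * (u i / U) + b * (v i / V)"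
    proof (cases "u i = 0 \<or> v i = 0")
      case True
      then show ?thesis
        using pos u[OF i] v[OF i] ab by auto
    next
      case False
      then show ?thesis
        using pos u[OF i] v[OF i] ab by (intro Youngs_inequality_0) auto
    qed
  qed
  also have "\<dots> = a * (U / U) + b * (V / V)"
    unfolding sum.distrib U_def V_def sum_distrib_left sum_divide_distrib by simp
  also have "\<dots> = 1"
    using pos ab by simp
  finally show ?thesis
    using pos by (simp add: U_def V_def mult_left_mono)
qed

text \<open>
  The right-hand side is \<open>2\<^sup>-\<^sup>a \<kappa>\<^sup>1\<^sup>+\<^sup>a\<close> with \<open>a = 1 - 1 / r \<le> 1\<close>, and \<open>1 + a \<le> r\<close> amounts to \<open>(r - 1)\<^sup>2 \<ge> 0\<close>.
\<close>

lemma decoupling_constant: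
  fixes r \<kappa> :: real
  assumes "1 \<le> r" "0 < \<kappa>" "\<kappa> \<le> 1"
  shows "1 / 2 * \<kappa> powr r \<le> \<kappa> * (2 / \<kappa>) powr - (1 - 1 / r)"
proof -
  have "2 - 1 / r \<le> r"
  proof -
    have "0 \<le> (r - 1)\<^sup>2"
      by simp
    then show ?thesis
      using assms by (simp add: field_simps power2_eq_square)
  qed
  then have "\<kappa> powr r \<le> \<kappa> powr (2 - 1 / r)"
    using assms by (intro powr_mono') auto
  moreover have "1 / 2 \<le> (2::real) powr - (1 - 1 / r)"
    using assms powr_mono[of "-1" "- (1 - 1 / r)" "2::real"] by (simp add: powr_minus_divide)
  moreover have "\<kappa> * (2 / \<kappa>) powr - (1 - 1 / r) = 2 powr - (1 - 1 / r) * \<kappa> powr (2 - 1 / r)"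
    using assms powr_add[of \<kappa> 1 "1 - 1 / r"]
    by (simp add: powr_divide powr_minus field_simps)
  ultimately show ?thesis
    using assms mult_mono[of "1 / 2" "2 powr - (1 - 1 / r)" "\<kappa> powr r" "\<kappa> powr (2 - 1 / r)"] by simp
qed

text \<open>
  Pairing \<open>\<bar>x\<bar>\<close> with the test function at level \<open>t\<close> gives, with no loss, a multiple of the \<open>r\<close>-th power of
  the truncation of \<open>x\<close> plus the size of the remainder; these are the costs of the two parts of the
  decomposition that cuts at \<open>t\<close>.
\<close>

lemma truncation_identity:
  fixes x t r :: real
  assumes "0 < t" "1 \<le> r"
  shows "\<bar>x\<bar> * ((min \<bar>x\<bar> t / t) powr r) powr (1 - 1 / r)
    = t powr (1 - r) * (min \<bar>x\<bar> t) powr r + max (\<bar>x\<bar> - t) 0"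
proof (cases "\<bar>x\<bar> \<le> t")
  case True
  have e: "r * (1 - 1 / r) = r - 1"
    using assms by (simp add: field_simps)
  show ?thesis
  proof (cases "x = 0")
    case False
    then have "\<bar>x\<bar> * (\<bar>x\<bar> / t) powr (r - 1) = t powr (1 - r) * \<bar>x\<bar> powr r"
      using assms by (simp add: powr_divide powr_diff field_simps)
    then show ?thesis
      using True by (simp add: powr_powr e)
  qed (use assms in simp)
next
  case False
  then show ?thesis
    using assms by (simp add: powr_add[symmetric])
qed

section \<open>Sums and powers of extended nonnegative reals\<close>

lemma enn_powr_ennreal: "0 \<le> x \<Longrightarrow> enn_powr (ennreal x) p = ennreal (x powr p)"
  by (simp add: enn_powr_def)

lemma enn_powr_mono: "x \<le> y \<Longrightarrow> 0 \<le> p \<Longrightarrow> enn_powr x p \<le> enn_powr y p"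
  by (auto simp: enn_powr_def top_unique less_top intro!: ennreal_leI powr_mono2 enn2real_mono)

lemma sum_le_infsum_ennreal:
  fixes f :: "'i \<Rightarrow> ennreal"
  assumes "finite F" "F \<subseteq> I"
  shows "sum f F \<le> infsum f I"
  unfolding infsum_finite[OF \<open>finite F\<close>, symmetric]
  using assms by (intro infsum_mono_neutral) (auto intro: nonneg_summable_on_complete)

lemma infsum_ennreal_le:
  fixes f :: "'i \<Rightarrow> ennreal"
  assumes "\<And>F. finite F \<Longrightarrow> F \<subseteq> I \<Longrightarrow> sum f F \<le> b"
  shows "infsum f I \<le> b"
  by (subst nonneg_infsum_complete) (auto intro!: SUP_least assms)

lemma infsum_cmult_ennreal:
  fixes f :: "'i \<Rightarrow> ennreal"
  shows "(\<Sum>\<^sub>\<infinity>i\<in>I. c * f i) = c * infsum f I"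
  by (simp add: nonneg_infsum_complete SUP_mult_left_ennreal sum_distrib_left)

text \<open>
  Monotonicity replaces continuity of \<open>\<Phi>\<close>. Write \<open>t\<^sub>0\<close> for the infimum. Some \<open>t \<in> T\<close> lie arbitrarily close to
  \<open>t\<^sub>0\<close> on the right, with \<open>\<Phi> t\<^sub>0 \<le> \<Phi> t \<le> t\<^sup>r\<close>, while every \<open>s < t\<^sub>0\<close> lies outside \<open>T\<close>, with
  \<open>s\<^sup>r < \<Phi> s \<le> \<Phi> t\<^sub>0\<close>; both bounds tend to \<open>t\<^sub>0\<^sup>r\<close>.
\<close>

lemma mono_eq_powr_at_first_crossing:
  fixes \<Phi> :: "real \<Rightarrow> ennreal"
  assumes \<Phi>_mono: "\<And>s t. 0 \<le> s \<Longrightarrow> s \<le> t \<Longrightarrow> \<Phi> s \<le> \<Phi> t"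
    and T_def: "T = {t. 0 < t \<and> \<Phi> t \<le> ennreal (t powr r)}" and "T \<noteq> {}"
    and t0: "0 < Inf T"
  shows "\<Phi> (Inf T) = ennreal (Inf T powr r)"
proof -
  define t0 where "t0 = Inf T"
  note t0 = t0[folded t0_def]
  have bdd: "bdd_below T"
    by (auto simp: T_def intro!: bdd_belowI[of _ 0])
  have near: "\<exists>t\<in>T. t < t0 + \<epsilon>" if "0 < \<epsilon>" for \<epsilon>
    using cInf_lessD[OF \<open>T \<noteq> {}\<close>, of "t0 + \<epsilon>"] that by (auto simp: t0_def)
  have lim: "((\<lambda>t. ennreal (t powr r)) \<longlongrightarrow> ennreal (t0 powr r)) (at t0)"
    using t0 by (intro tendsto_ennrealI tendsto_powr tendsto_ident_at tendsto_const) auto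
  have "\<Phi> t0 = ennreal (t0 powr r)"
  proof (rule antisym)
    show "\<Phi> t0 \<le> ennreal (t0 powr r)"
    proof (rule ccontr)
      assume "\<not> \<Phi> t0 \<le> ennreal (t0 powr r)"
      then have gt: "ennreal (t0 powr r) < \<Phi> t0"
        by simp
      then obtain \<delta> where \<delta>: "0 < \<delta>" "\<And>t. t \<noteq> t0 \<Longrightarrow> dist t t0 < \<delta> \<Longrightarrow> ennreal (t powr r) < \<Phi> t0"
        using order_tendstoD(2)[OF lim, of "\<Phi> t0"] gt by (auto simp: eventually_at)
      obtain t where t: "t \<in> T" "t < t0 + \<delta>"
        using near \<delta>(1) by blast
      have "t0 \<le> t"
        unfolding t0_def using t(1) bdd by (rule cInf_lower)
      then have "\<Phi> t0 \<le> ennreal (t powr r)"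
        using \<Phi>_mono[of t0 t] t(1) t0 by (auto simp: T_def)
      then show False
        using \<delta>(2)[of t] t \<open>t0 \<le> t\<close> gt by (cases "t = t0") (auto simp: dist_real_def)
    qed
    have "\<forall>\<^sub>F t in at_left t0. ennreal (t powr r) \<le> \<Phi> t0"
      unfolding eventually_at_left_field
    proof (intro exI[of _ 0] conjI allI impI t0)
      fix t assume t: "0 < t" "t < t0"
      then have "t \<notin> T"
        using cInf_lower[OF _ bdd] by (force simp: t0_def)
      then show "ennreal (t powr r) \<le> \<Phi> t0"
        using t \<Phi>_mono[of t t0] by (auto simp: T_def not_le)
    qed
    then show "ennreal (t0 powr r) \<le> \<Phi> t0"
      using tendsto_within_subset[OF lim, of "{..<t0}"] by (intro tendsto_upperbound) auto
  qed
  then show ?thesis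
    by (simp add: t0_def)
qed

section \<open>Decoupling the weights from the other variables\<close>

context prob_space
begin

lemma bounded_times_weight_expectation_ge:
  fixes X W :: "'a \<Rightarrow> real" and q :: "real \<Rightarrow> real"
  assumes X[measurable]: "X \<in> borel_measurable M" and W[measurable]: "W \<in> borel_measurable M"
    and W01: "\<And>\<omega>. \<omega> \<in> space M \<Longrightarrow> W \<omega> \<in> {0..1}"
    and cond: "AE \<omega> in M. \<kappa> \<le> real_cond_exp M (vimage_algebra (space M) X borel) W \<omega>"
    and q[measurable]: "q \<in> borel_measurable borel" and q0: "\<And>x. 0 \<le> q x" and qB: "\<And>x. q x \<le> B"
  shows "\<kappa> * expectation (\<lambda>\<omega>. q (X \<omega>)) \<le> expectation (\<lambda>\<omega>. q (X \<omega>) * W \<omega>)"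
proof -
  let ?A = "vimage_algebra (space M) X borel"
  have sub: "subalgebra M ?A"
    unfolding subalgebra_def using X by (simp add: measurable_iff_sets)
  interpret finite_measure_subalgebra M ?A
    by unfold_locales (rule sub)
  have [measurable]: "(\<lambda>\<omega>. q (X \<omega>)) \<in> borel_measurable ?A"
    by (rule measurable_compose[OF measurable_vimage_algebra1 q]) simp
  have int_qW: "integrable M (\<lambda>\<omega>. q (X \<omega>) * W \<omega>)"
  proof (rule integrable_const_bound[where B=B])
    have "q (X \<omega>) * W \<omega> \<le> B * 1" if "\<omega> \<in> space M" for \<omega>
      using W01[OF that] q0[of "X \<omega>"] qB[of "X \<omega>"] by (intro mult_mono) auto
    then show "AE \<omega> in M. norm (q (X \<omega>) * W \<omega>) \<le> B"
      using W01 q0 by (auto simp: abs_mult)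
  qed simp
  note c = real_cond_exp_intg[OF int_qW]
  have int_q: "integrable M (\<lambda>\<omega>. q (X \<omega>))"
    using q0 qB by (intro integrable_const_bound[where B=B]) auto
  have "\<kappa> * expectation (\<lambda>\<omega>. q (X \<omega>)) = expectation (\<lambda>\<omega>. q (X \<omega>) * \<kappa>)"
    by simp
  also have "\<dots> \<le> expectation (\<lambda>\<omega>. q (X \<omega>) * real_cond_exp M ?A W \<omega>)"
    using cond q0 c int_q by (intro integral_mono_AE) (auto intro: mult_left_mono)
  also have "\<dots> = expectation (\<lambda>\<omega>. q (X \<omega>) * W \<omega>)"
    by (rule c) simp_all
  finally show ?thesis .
qed

text \<open>
  The weight is not independent of \<open>D\<close>, so \<open>E(W D\<^sup>-\<^sup>a)\<close> cannot be factored. Bounding \<open>D\<^sup>-\<^sup>a\<close> below by an affine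
  function of \<open>D\<close> leaves only \<open>E(q(X) W)\<close>, controlled by the conditional expectation, and
  \<open>E(q(X) W D) \<le> E(q(X) D)\<close>, where the weight is gone. The tangent point \<open>2 / \<kappa>\<close> is a bound for the mean of
  \<open>D\<close> under the measure with density proportional to \<open>q(X) W\<close>, which makes the estimate agree with
  Jensen's inequality under that measure.
\<close>

lemma bounded_decoupling:
  fixes X W D :: "'a \<Rightarrow> real" and q :: "real \<Rightarrow> real"
  assumes X[measurable]: "X \<in> borel_measurable M" and W[measurable]: "W \<in> borel_measurable M"
    and W01: "\<And>\<omega>. \<omega> \<in> space M \<Longrightarrow> W \<omega> \<in> {0..1}"
    and cond: "AE \<omega> in M. \<kappa> \<le> real_cond_exp M (vimage_algebra (space M) X borel) W \<omega>"
    and \<kappa>: "0 < \<kappa>" and a: "0 \<le> a"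
    and q[measurable]: "q \<in> borel_measurable borel" and q0: "\<And>x. 0 \<le> q x" and qB: "\<And>x. q x \<le> B"
    and D[measurable]: "D \<in> borel_measurable M" and D1: "\<And>\<omega>. 1 \<le> D \<omega>" and DB: "\<And>\<omega>. D \<omega> \<le> C"
    and qD: "expectation (\<lambda>\<omega>. q (X \<omega>) * D \<omega>) \<le> 2 * expectation (\<lambda>\<omega>. q (X \<omega>))"
  shows "\<kappa> * (2 / \<kappa>) powr -a * expectation (\<lambda>\<omega>. q (X \<omega>))
    \<le> expectation (\<lambda>\<omega>. q (X \<omega>) * (W \<omega> * D \<omega> powr -a))"
proof -
  define c where "c = 2 / \<kappa>"
  have c: "0 < c" "2 / c = \<kappa>"
    using \<kappa> by (simp_all add: c_def)
  let ?Q = "\<lambda>\<omega>. q (X \<omega>)"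
  have B: "0 \<le> B" and C: "0 \<le> C"
    using q0[of 0] qB[of 0] D1[of undefined] DB[of undefined] by linarith+
  have bound: "integrable M (\<lambda>\<omega>. q (X \<omega>) * f \<omega>)"
    if "f \<in> borel_measurable M" "\<And>\<omega>. \<omega> \<in> space M \<Longrightarrow> \<bar>f \<omega>\<bar> \<le> K" for f K
  proof (rule integrable_const_bound[where B="B * K"])
    show "AE \<omega> in M. norm (q (X \<omega>) * f \<omega>) \<le> B * K"
      using that(2) q0 qB B by (auto simp: abs_mult intro!: AE_I2 mult_mono)
  qed (use that(1) in simp)
  have int: "integrable M (\<lambda>\<omega>. ?Q \<omega> * W \<omega>)" "integrable M (\<lambda>\<omega>. ?Q \<omega> * D \<omega>)"
    "integrable M (\<lambda>\<omega>. ?Q \<omega> * (W \<omega> * D \<omega> powr -a))"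
  proof -
    show "integrable M (\<lambda>\<omega>. ?Q \<omega> * W \<omega>)"
      using W01 by (intro bound[of _ 1]) auto
    show "integrable M (\<lambda>\<omega>. ?Q \<omega> * D \<omega>)"
      using D1 DB by (intro bound[of _ C]) (auto simp: abs_if order.trans[OF _ D1] less_le_not_le)
    have "D \<omega> powr -a \<le> 1" for \<omega>
      using D1[of \<omega>] a powr_mono[of "-a" 0 "D \<omega>"] by simp
    then show "integrable M (\<lambda>\<omega>. ?Q \<omega> * (W \<omega> * D \<omega> powr -a))"
      using W01 by (intro bound[of _ 1]) (auto simp: abs_mult mult_le_one)
  qed
  have "\<kappa> * c powr -a * expectation ?Q
      = c powr -a * ((1 + a) * (\<kappa> * expectation ?Q) - a / c * (2 * expectation ?Q))"
    using c by (simp add: field_simps)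
  also have "\<dots> \<le> c powr -a * ((1 + a) * expectation (\<lambda>\<omega>. ?Q \<omega> * W \<omega>)
      - a / c * expectation (\<lambda>\<omega>. ?Q \<omega> * D \<omega>))"
    using a c qD bounded_times_weight_expectation_ge[OF X W W01 cond q q0 qB]
    by (intro mult_left_mono diff_mono) auto
  also have "\<dots> = expectation (\<lambda>\<omega>. c powr -a * ((1 + a) * (?Q \<omega> * W \<omega>) - a / c * (?Q \<omega> * D \<omega>)))"
    using int by simp
  \<comment> \<open>Pointwise, first the weight in front of \<open>D\<close> comes back by \<open>W \<le> 1\<close>, then the tangent bound applies.\<close>
  also have "\<dots> \<le> expectation (\<lambda>\<omega>. ?Q \<omega> * (W \<omega> * D \<omega> powr -a))"
  proof (rule integral_mono)
    fix \<omega> assume \<omega>: "\<omega> \<in> space M"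
    have "c powr -a * ((1 + a) * W \<omega> - a / c * D \<omega>) \<le> c powr -a * ((1 + a) * W \<omega> - a / c * (W \<omega> * D \<omega>))"
      using W01[OF \<omega>] D1[of \<omega>] a c
      by (intro mult_left_mono diff_mono order_refl mult_left_le_one_le) auto
    also have "\<dots> = W \<omega> * (c powr -a * (1 + a - a * (D \<omega> / c)))"
      by (simp add: algebra_simps)
    also have "\<dots> \<le> W \<omega> * D \<omega> powr -a"
      using W01[OF \<omega>] D1[of \<omega>] a c by (intro mult_left_mono powr_neg_tangent) auto
    finally have "?Q \<omega> * (c powr -a * ((1 + a) * W \<omega> - a / c * D \<omega>)) \<le> ?Q \<omega> * (W \<omega> * D \<omega> powr -a)"
      by (rule mult_left_mono) (rule q0)
    then show "c powr -a * ((1 + a) * (?Q \<omega> * W \<omega>) - a / c * (?Q \<omega> * D \<omega>)) \<le> ?Q \<omega> * (W \<omega> * D \<omega> powr -a)"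
      by (simp add: algebra_simps)
  qed (use int in simp_all)
  finally show ?thesis
    unfolding c_def .
qed

end

section \<open>The lower bound from test functions\<close>

locale weighted_independent_family = prob_space M for M :: "'a measure" +
  fixes I :: "'i set" and X W :: "'i \<Rightarrow> 'a \<Rightarrow> real" and r \<kappa> :: real
  assumes indep: "indep_vars (\<lambda>_. borel) X I"
    and W[measurable]: "\<And>i. i \<in> I \<Longrightarrow> W i \<in> borel_measurable M"
    and W01: "\<And>i \<omega>. i \<in> I \<Longrightarrow> \<omega> \<in> space M \<Longrightarrow> W i \<omega> \<in> {0..1}"
    and cond: "\<And>i. i \<in> I \<Longrightarrow>
      AE \<omega> in M. \<kappa> \<le> real_cond_exp M (vimage_algebra (space M) (X i) borel) (W i) \<omega>"
    and \<kappa>: "0 < \<kappa>" and r: "1 \<le> r"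
begin

lemma X[measurable]: "i \<in> I \<Longrightarrow> X i \<in> borel_measurable M"
  using indep by (simp add: indep_vars_def)

abbreviation "weighted_norm \<omega> \<equiv> enn_powr (\<Sum>\<^sub>\<infinity>i\<in>I. ennreal (\<bar>W i \<omega> * X i \<omega>\<bar> powr r)) (1 / r)"

abbreviation "truncated_moment t \<equiv> \<Sum>\<^sub>\<infinity>i\<in>I. \<integral>\<^sup>+\<omega>. ennreal ((min \<bar>X i \<omega>\<bar> t) powr r) \<partial>M"

abbreviation "excess t \<equiv> \<Sum>\<^sub>\<infinity>i\<in>I. \<integral>\<^sup>+\<omega>. ennreal (max (\<bar>X i \<omega>\<bar> - t) 0) \<partial>M"

text \<open>
  Independence enters here, and only to factor \<open>E(q(X\<^sub>i) h\<^sub>j(X\<^sub>j))\<close> for \<open>j \<noteq> i\<close>. Cutting \<open>q\<close> at height \<open>n\<close> keeps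
  all expectations finite, so that the affine bound may be integrated; then \<open>n\<close> tends to infinity.
\<close>

lemma decoupling:
  fixes q :: "real \<Rightarrow> real" and h :: "'i \<Rightarrow> real \<Rightarrow> real"
  assumes F: "finite F" "F \<subseteq> I" and i: "i \<in> F" and a: "0 \<le> a"
    and q[measurable]: "q \<in> borel_measurable borel" and q0: "\<And>x. 0 \<le> q x"
    and h[measurable]: "\<And>j. h j \<in> borel_measurable borel" and h0: "\<And>j x. 0 \<le> h j x" and h1: "\<And>j x. h j x \<le> 1"
    and sum_h: "(\<Sum>j\<in>F. expectation (\<lambda>\<omega>. h j (X j \<omega>))) \<le> 1"
  shows "ennreal (\<kappa> * (2 / \<kappa>) powr -a) * (\<integral>\<^sup>+\<omega>. ennreal (q (X i \<omega>)) \<partial>M)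
    \<le> (\<integral>\<^sup>+\<omega>. ennreal (q (X i \<omega>) * (W i \<omega> * (1 + (\<Sum>j\<in>F - {i}. h j (X j \<omega>))) powr -a)) \<partial>M)"
proof -
  define D where "D = (\<lambda>\<omega>. 1 + (\<Sum>j\<in>F - {i}. h j (X j \<omega>)))"
  define c where "c = \<kappa> * (2 / \<kappa>) powr -a"
  let ?R = "\<integral>\<^sup>+\<omega>. ennreal (q (X i \<omega>) * (W i \<omega> * D \<omega> powr -a)) \<partial>M"
  have c: "0 \<le> c"
    using \<kappa> by (simp add: c_def)
  have iI: "i \<in> I"
    using i F by auto
  note X[OF iI, measurable] W[OF iI, measurable]
  have X_F[measurable]: "X j \<in> borel_measurable M" if "j \<in> F" for j
    using that F by auto
  have D[measurable]: "D \<in> borel_measurable M"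
    unfolding D_def by measurable
  have D1: "1 \<le> D \<omega>" and DB: "D \<omega> \<le> 1 + real (card (F - {i}))" for \<omega>
    using sum_nonneg[of "F - {i}" "\<lambda>j. h j (X j \<omega>)"] h0
      sum_mono[of "F - {i}" "\<lambda>j. h j (X j \<omega>)" "\<lambda>_. 1"] h1 by (auto simp: D_def)
  have trunc: "c * expectation (\<lambda>\<omega>. min (q (X i \<omega>)) n)
      \<le> expectation (\<lambda>\<omega>. min (q (X i \<omega>)) n * (W i \<omega> * D \<omega> powr -a))" if n: "0 \<le> n" for n
  proof -
    let ?Q = "\<lambda>\<omega>. min (q (X i \<omega>)) n"
    have int_Q: "integrable M ?Q"
      using q0 n by (intro integrable_const_bound[where B=n]) auto
    have int_h: "integrable M (\<lambda>\<omega>. h j (X j \<omega>))" if "j \<in> F" for j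
      using h0 h1 that by (intro integrable_const_bound[where B=1]) auto
    have prod: "integrable M (\<lambda>\<omega>. ?Q \<omega> * h j (X j \<omega>))"
      "expectation (\<lambda>\<omega>. ?Q \<omega> * h j (X j \<omega>)) = expectation ?Q * expectation (\<lambda>\<omega>. h j (X j \<omega>))"
      if j: "j \<in> F - {i}" for j
    proof -
      have ij: "i \<noteq> j"
        using j by auto
      define f where "f = (\<lambda>k x. if k = i then min (q x) n else h k x)"
      have ind: "indep_vars (\<lambda>_. borel) (\<lambda>k \<omega>. f k (X k \<omega>)) {i, j}"
        using i j F by (intro indep_vars_compose2[OF indep_vars_subset[OF indep]]) (auto simp: f_def)
      have int_f: "integrable M (\<lambda>\<omega>. f k (X k \<omega>))" if "k \<in> {i, j}" for k
        using that int_Q int_h j by (auto simp: f_def)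
      have f: "f i x = min (q x) n" "f j x = h j x" for x
        using j by (auto simp: f_def)
      show "integrable M (\<lambda>\<omega>. ?Q \<omega> * h j (X j \<omega>))"
        using indep_vars_integrable[OF _ ind int_f] ij by (simp add: f)
      show "expectation (\<lambda>\<omega>. ?Q \<omega> * h j (X j \<omega>)) = expectation ?Q * expectation (\<lambda>\<omega>. h j (X j \<omega>))"
        using indep_vars_lebesgue_integral[OF _ ind int_f] ij by (simp add: f)
    qed
    have "expectation (\<lambda>\<omega>. ?Q \<omega> * D \<omega>) = expectation (\<lambda>\<omega>. ?Q \<omega> + (\<Sum>j\<in>F - {i}. ?Q \<omega> * h j (X j \<omega>)))"
      by (simp add: D_def algebra_simps sum_distrib_left)
    also have "\<dots> = expectation ?Q + (\<Sum>j\<in>F - {i}. expectation ?Q * expectation (\<lambda>\<omega>. h j (X j \<omega>)))"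
      using int_Q prod(1) by (subst Bochner_Integration.integral_add) (auto simp: prod(2) intro!: sum.cong Bochner_Integration.integrable_sum)
    also have "\<dots> = expectation ?Q * (1 + (\<Sum>j\<in>F - {i}. expectation (\<lambda>\<omega>. h j (X j \<omega>))))"
      by (simp add: algebra_simps sum_distrib_left)
    also have "\<dots> \<le> expectation ?Q * (1 + 1)"
    proof (intro mult_left_mono add_left_mono)
      have "(\<Sum>j\<in>F - {i}. expectation (\<lambda>\<omega>. h j (X j \<omega>))) \<le> (\<Sum>j\<in>F. expectation (\<lambda>\<omega>. h j (X j \<omega>)))"
        using F(1) h0 by (intro sum_mono2) auto
      then show "(\<Sum>j\<in>F - {i}. expectation (\<lambda>\<omega>. h j (X j \<omega>))) \<le> 1"
        using sum_h by linarith
      show "0 \<le> expectation ?Q"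
        using q0 n by (intro integral_nonneg_AE) auto
    qed
    finally have QD: "expectation (\<lambda>\<omega>. ?Q \<omega> * D \<omega>) \<le> 2 * expectation ?Q"
      by simp
    show ?thesis
      unfolding c_def using q0 n
      by (intro bounded_decoupling[OF X[OF iI] W[OF iI] W01[OF iI] cond[OF iI] \<kappa> a, where q="\<lambda>x. min (q x) n" and B=n, OF _ _ _ _ D D1 DB QD]) auto
  qed
  have le: "ennreal c * (\<integral>\<^sup>+\<omega>. ennreal (min (q (X i \<omega>)) (real n)) \<partial>M) \<le> ?R" for n
  proof -
    have Da: "D \<omega> powr -a \<le> 1" for \<omega>
      using D1[of \<omega>] a powr_mono[of "-a" 0 "D \<omega>"] by simp
    have "ennreal c * (\<integral>\<^sup>+\<omega>. ennreal (min (q (X i \<omega>)) (real n)) \<partial>M)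
        = ennreal (c * expectation (\<lambda>\<omega>. min (q (X i \<omega>)) (real n)))"
      using q0 c by (subst nn_integral_eq_integral)
        (auto intro!: integrable_const_bound[where B="real n"] simp: ennreal_mult integral_nonneg_AE)
    also have "\<dots> \<le> ennreal (expectation (\<lambda>\<omega>. min (q (X i \<omega>)) (real n) * (W i \<omega> * D \<omega> powr -a)))"
      by (intro ennreal_leI trunc) simp
    also have "\<dots> = (\<integral>\<^sup>+\<omega>. ennreal (min (q (X i \<omega>)) (real n) * (W i \<omega> * D \<omega> powr -a)) \<partial>M)"
    proof (rule nn_integral_eq_integral[symmetric])
      have "min (q (X i \<omega>)) (real n) * (W i \<omega> * D \<omega> powr -a) \<le> real n * (1 * 1)" if "\<omega> \<in> space M" for \<omega>
        using q0 W01[OF iI that] Da by (intro mult_mono) auto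
      then show "integrable M (\<lambda>\<omega>. min (q (X i \<omega>)) (real n) * (W i \<omega> * D \<omega> powr -a))"
        using q0 W01[OF iI] by (intro integrable_const_bound[where B="real n"]) (auto simp: abs_mult)
      show "AE \<omega> in M. 0 \<le> min (q (X i \<omega>)) (real n) * (W i \<omega> * D \<omega> powr -a)"
        using q0 W01[OF iI] by auto
    qed
    also have "\<dots> \<le> ?R"
      using W01[OF iI] by (intro nn_integral_mono ennreal_leI mult_right_mono) auto
    finally show ?thesis .
  qed
  have "(\<lambda>n. \<integral>\<^sup>+\<omega>. ennreal (min (q (X i \<omega>)) (real n)) \<partial>M) \<longlonglongrightarrow> (\<integral>\<^sup>+\<omega>. ennreal (q (X i \<omega>)) \<partial>M)"
  proof (rule nn_integral_LIMSEQ)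
    show "incseq (\<lambda>n \<omega>. ennreal (min (q (X i \<omega>)) (real n)))"
      by (auto simp: incseq_def le_fun_def intro!: ennreal_leI)
    show "(\<lambda>n. ennreal (min (q (X i \<omega>)) (real n))) \<longlonglongrightarrow> ennreal (q (X i \<omega>))" for \<omega>
    proof (rule tendsto_eventually)
      obtain k where "q (X i \<omega>) \<le> real k"
        using real_arch_simple by blast
      then show "\<forall>\<^sub>F n in sequentially. ennreal (min (q (X i \<omega>)) (real n)) = ennreal (q (X i \<omega>))"
        by (intro eventually_sequentiallyI[of k]) (auto simp: min_def)
    qed
  qed simp
  then have "(\<lambda>n. ennreal c * (\<integral>\<^sup>+\<omega>. ennreal (min (q (X i \<omega>)) (real n)) \<partial>M))
      \<longlonglongrightarrow> ennreal c * (\<integral>\<^sup>+\<omega>. ennreal (q (X i \<omega>)) \<partial>M)"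
    by (intro ennreal_tendsto_cmult) simp_all
  then have "ennreal c * (\<integral>\<^sup>+\<omega>. ennreal (q (X i \<omega>)) \<partial>M) \<le> ?R"
    by (rule LIMSEQ_le_const2) (use le in blast)
  then show ?thesis
    by (simp add: c_def D_def)
qed

text \<open>
  Hoelder produces the factor \<open>H\<^sup>-\<^sup>a\<close> with \<open>H = \<Sum>\<^sub>j h\<^sub>j(X\<^sub>j)\<close>, which depends on \<open>X\<^sub>i\<close>. Since \<open>h\<^sub>i \<le> 1\<close>, it may be replaced by
  \<open>D\<^sub>i\<^sup>-\<^sup>a\<close>, which involves only the other variables, and the summands decouple one by one.
\<close>

lemma finite_test_function_lower_bound:
  fixes h :: "'i \<Rightarrow> real \<Rightarrow> real"
  assumes F: "finite F" "F \<subseteq> I"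
    and h[measurable]: "\<And>j. h j \<in> borel_measurable borel" and h0: "\<And>j x. 0 \<le> h j x" and h1: "\<And>j x. h j x \<le> 1"
    and sum_h: "(\<Sum>j\<in>F. expectation (\<lambda>\<omega>. h j (X j \<omega>))) \<le> 1"
  shows "ennreal (1 / 2 * \<kappa> powr r) * (\<Sum>i\<in>F. \<integral>\<^sup>+\<omega>. ennreal (\<bar>X i \<omega>\<bar> * h i (X i \<omega>) powr (1 - 1 / r)) \<partial>M)
    \<le> (\<integral>\<^sup>+\<omega>. weighted_norm \<omega> \<partial>M)"
proof -
  define a where "a = 1 - 1 / r"
  define D where "D = (\<lambda>i \<omega>. 1 + (\<Sum>j\<in>F - {i}. h j (X j \<omega>)))"
  have a: "0 \<le> a"
    using r by (simp add: a_def)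
  have X_F[measurable]: "X i \<in> borel_measurable M" and W_F[measurable]: "W i \<in> borel_measurable M" if "i \<in> F" for i
    using that F by auto
  have W01_F: "W i \<omega> \<in> {0..1}" if "i \<in> F" "\<omega> \<in> space M" for i \<omega>
    using W01[OF _ that(2)] that(1) F by auto
  have D1: "1 \<le> D i \<omega>" for i \<omega>
    using sum_nonneg[of "F - {i}" "\<lambda>j. h j (X j \<omega>)"] h0 by (auto simp: D_def)
  have D[measurable]: "D i \<in> borel_measurable M" if "i \<in> F" for i
    unfolding D_def by measurable
  \<comment> \<open>A family with an index forces \<open>\<kappa> \<le> 1\<close>, because \<open>\<kappa> \<le> E W\<^sub>i \<le> 1\<close>.\<close>
  have term_le: "ennreal (1 / 2 * \<kappa> powr r) * (\<integral>\<^sup>+\<omega>. ennreal (\<bar>X i \<omega>\<bar> * h i (X i \<omega>) powr a) \<partial>M)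
    \<le> (\<integral>\<^sup>+\<omega>. ennreal (\<bar>X i \<omega>\<bar> * h i (X i \<omega>) powr a * (W i \<omega> * D i \<omega> powr -a)) \<partial>M)" if i: "i \<in> F" for i
  proof -
    have iI: "i \<in> I"
      using i F by auto
    have "\<kappa> \<le> expectation (\<lambda>\<omega>. W i \<omega>)"
      using bounded_times_weight_expectation_ge[OF X[OF iI] W[OF iI] W01[OF iI] cond[OF iI], of "\<lambda>_. 1" 1]
      by (simp add: prob_space)
    also have "\<dots> \<le> expectation (\<lambda>_. 1)"
      using W01[OF iI] W[OF iI] by (intro integral_mono integrable_const_bound[where B=1]) auto
    finally have "\<kappa> \<le> 1"
      by (simp add: prob_space)
    then have "ennreal (1 / 2 * \<kappa> powr r) \<le> ennreal (\<kappa> * (2 / \<kappa>) powr -a)"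
      unfolding a_def by (intro ennreal_leI decoupling_constant r \<kappa>)
    moreover have "ennreal (\<kappa> * (2 / \<kappa>) powr -a) * (\<integral>\<^sup>+\<omega>. ennreal (\<bar>X i \<omega>\<bar> * h i (X i \<omega>) powr a) \<partial>M)
      \<le> (\<integral>\<^sup>+\<omega>. ennreal (\<bar>X i \<omega>\<bar> * h i (X i \<omega>) powr a * (W i \<omega> * D i \<omega> powr -a)) \<partial>M)"
      unfolding D_def
      by (rule decoupling[OF F i a _ _ h h0 h1 sum_h,
            where q="\<lambda>x. \<bar>x\<bar> * h i x powr a"]) simp_all
    ultimately show ?thesis
      by (meson mult_right_mono order_trans zero_le)
  qed
  have "ennreal (1 / 2 * \<kappa> powr r) * (\<Sum>i\<in>F. \<integral>\<^sup>+\<omega>. ennreal (\<bar>X i \<omega>\<bar> * h i (X i \<omega>) powr a) \<partial>M)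
    \<le> (\<Sum>i\<in>F. \<integral>\<^sup>+\<omega>. ennreal (\<bar>X i \<omega>\<bar> * h i (X i \<omega>) powr a * (W i \<omega> * D i \<omega> powr -a)) \<partial>M)"
    unfolding sum_distrib_left by (intro sum_mono term_le)
  also have "\<dots> = (\<integral>\<^sup>+\<omega>. (\<Sum>i\<in>F. ennreal (\<bar>X i \<omega>\<bar> * h i (X i \<omega>) powr a * (W i \<omega> * D i \<omega> powr -a))) \<partial>M)"
    by (intro nn_integral_sum[symmetric]) measurable
  also have "\<dots> \<le> (\<integral>\<^sup>+\<omega>. ennreal ((\<Sum>i\<in>F. \<bar>W i \<omega> * X i \<omega>\<bar> powr r) powr (1 / r)) \<partial>M)"
  proof (rule nn_integral_mono)
    fix \<omega> assume \<omega>: "\<omega> \<in> space M"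
    define H where "H = (\<Sum>j\<in>F. h j (X j \<omega>))"
    let ?S = "(\<Sum>i\<in>F. \<bar>W i \<omega> * X i \<omega>\<bar> powr r) powr (1 / r)"
    have H: "0 \<le> H"
      unfolding H_def by (intro sum_nonneg h0)
    have "\<bar>X i \<omega>\<bar> * h i (X i \<omega>) powr a * (W i \<omega> * D i \<omega> powr -a)
        \<le> (\<bar>W i \<omega> * X i \<omega>\<bar> powr r) powr (1 / r) * h i (X i \<omega>) powr a * H powr -a" if i: "i \<in> F" for i
    \<comment> \<open>If \<open>h\<^sub>i\<close> vanishes, both sides do; otherwise \<open>H\<close> is positive, so that \<open>H\<^sup>-\<^sup>a\<close> has its usual meaning.\<close>
    proof (cases "h i (X i \<omega>) = 0")
      case False
      have split: "H = h i (X i \<omega>) + (\<Sum>j\<in>F - {i}. h j (X j \<omega>))"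
        unfolding H_def using F(1) i by (simp add: sum.remove)
      have "0 < H"
        unfolding split using False h0[of i "X i \<omega>"]
        by (intro add_pos_nonneg sum_nonneg h0) auto
      moreover have "H \<le> D i \<omega>"
        using h1[of i "X i \<omega>"] by (simp add: D_def split)
      ultimately have "D i \<omega> powr -a \<le> H powr -a"
        using a by (intro powr_mono2') auto
      then show ?thesis
        using W01_F[OF i \<omega>] r
        by (auto simp: powr_powr abs_mult mult_ac intro!: mult_left_mono mult_right_mono)
    qed simp
    then have "(\<Sum>i\<in>F. \<bar>X i \<omega>\<bar> * h i (X i \<omega>) powr a * (W i \<omega> * D i \<omega> powr -a))
        \<le> (\<Sum>i\<in>F. (\<bar>W i \<omega> * X i \<omega>\<bar> powr r) powr (1 / r) * h i (X i \<omega>) powr a) * H powr -a"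
      unfolding sum_distrib_right by (rule sum_mono)
    also have "\<dots> \<le> (?S * H powr a) * H powr -a"
      unfolding H_def using r h0 F(1) by (intro mult_right_mono Holder_sum) (auto simp: a_def)
    also have "\<dots> \<le> ?S"
      using H by (cases "H = 0") (auto simp: powr_minus field_simps)
    finally show "(\<Sum>i\<in>F. ennreal (\<bar>X i \<omega>\<bar> * h i (X i \<omega>) powr a * (W i \<omega> * D i \<omega> powr -a))) \<le> ennreal ?S"
      using W01_F[OF _ \<omega>] by (subst sum_ennreal) (auto intro!: ennreal_leI)
  qed
  also have "\<dots> = (\<integral>\<^sup>+\<omega>. enn_powr (\<Sum>i\<in>F. ennreal (\<bar>W i \<omega> * X i \<omega>\<bar> powr r)) (1 / r) \<partial>M)"
    by (simp add: enn_powr_ennreal sum_nonneg)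
  also have "\<dots> \<le> (\<integral>\<^sup>+\<omega>. weighted_norm \<omega> \<partial>M)"
    using r F by (intro nn_integral_mono enn_powr_mono sum_le_infsum_ennreal) auto
  finally show ?thesis
    unfolding a_def .
qed

lemma test_function_lower_bound:
  fixes h :: "'i \<Rightarrow> real \<Rightarrow> real"
  assumes h[measurable]: "\<And>j. h j \<in> borel_measurable borel" and h0: "\<And>j x. 0 \<le> h j x" and h1: "\<And>j x. h j x \<le> 1"
    and sum_h: "(\<Sum>\<^sub>\<infinity>j\<in>I. \<integral>\<^sup>+\<omega>. ennreal (h j (X j \<omega>)) \<partial>M) \<le> 1"
  shows "ennreal (1 / 2 * \<kappa> powr r) * (\<Sum>\<^sub>\<infinity>i\<in>I. \<integral>\<^sup>+\<omega>. ennreal (\<bar>X i \<omega>\<bar> * h i (X i \<omega>) powr (1 - 1 / r)) \<partial>M)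
    \<le> (\<integral>\<^sup>+\<omega>. weighted_norm \<omega> \<partial>M)"
  unfolding infsum_cmult_ennreal[symmetric]
proof (rule infsum_ennreal_le)
  fix F assume F: "finite F" "F \<subseteq> I"
  have "ennreal (\<Sum>j\<in>F. expectation (\<lambda>\<omega>. h j (X j \<omega>))) = (\<Sum>j\<in>F. \<integral>\<^sup>+\<omega>. ennreal (h j (X j \<omega>)) \<partial>M)"
    using F h0 h1
    by (subst sum_ennreal[symmetric], force intro: integral_nonneg_AE, intro sum.cong refl nn_integral_eq_integral[symmetric])
      (auto intro!: integrable_const_bound[where B=1])
  also have "\<dots> \<le> 1"
    using sum_le_infsum_ennreal[OF F] sum_h by (rule order_trans)
  finally have "(\<Sum>j\<in>F. expectation (\<lambda>\<omega>. h j (X j \<omega>))) \<le> 1"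
    by simp
  then show "(\<Sum>i\<in>F. ennreal (1 / 2 * \<kappa> powr r) * (\<integral>\<^sup>+\<omega>. ennreal (\<bar>X i \<omega>\<bar> * h i (X i \<omega>) powr (1 - 1 / r)) \<partial>M))
    \<le> (\<integral>\<^sup>+\<omega>. weighted_norm \<omega> \<partial>M)"
    unfolding sum_distrib_left[symmetric] by (intro finite_test_function_lower_bound F h h0 h1)
qed

section \<open>Truncation at a level\<close>

lemma scaled_truncation_bounds:
  assumes "0 < t"
  shows "(\<lambda>x. (min \<bar>x\<bar> t / t) powr r) \<in> borel_measurable borel"
    and "0 \<le> (min \<bar>x\<bar> t / t) powr r" and "(min \<bar>x\<bar> t / t) powr r \<le> 1"
  using assms r by (auto intro!: powr_le1)

lemma scaled_truncated_moment:
  assumes "0 < t" "i \<in> I"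
  shows "(\<integral>\<^sup>+\<omega>. ennreal ((min \<bar>X i \<omega>\<bar> t / t) powr r) \<partial>M)
    = ennreal (t powr -r) * (\<integral>\<^sup>+\<omega>. ennreal ((min \<bar>X i \<omega>\<bar> t) powr r) \<partial>M)"
  using assms
  by (subst nn_integral_cmult[symmetric]) (auto simp: ennreal_mult[symmetric] powr_divide powr_minus field_simps)

lemma truncated_moment_mono: "0 \<le> s \<Longrightarrow> s \<le> t \<Longrightarrow> truncated_moment s \<le> truncated_moment t"
  using r by (intro infsum_mono nn_integral_mono ennreal_leI powr_mono2) (auto intro: nonneg_summable_on_complete)

lemma truncation_lower_bound:
  assumes t: "0 < t" and moment_le: "truncated_moment t \<le> ennreal (t powr r)"
  shows "ennreal (1 / 2 * \<kappa> powr r) * (ennreal (t powr (1 - r)) * truncated_moment t + excess t)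
    \<le> (\<integral>\<^sup>+\<omega>. weighted_norm \<omega> \<partial>M)"
proof -
  have "(\<Sum>\<^sub>\<infinity>i\<in>I. \<integral>\<^sup>+\<omega>. ennreal ((min \<bar>X i \<omega>\<bar> t / t) powr r) \<partial>M) = ennreal (t powr -r) * truncated_moment t"
    using t by (simp add: scaled_truncated_moment infsum_cmult_ennreal cong: infsum_cong)
  also have "\<dots> \<le> ennreal (t powr -r) * ennreal (t powr r)"
    using moment_le by (rule mult_left_mono) simp
  also have "\<dots> = 1"
    using t by (simp add: ennreal_mult[symmetric] powr_add[symmetric])
  finally have "ennreal (1 / 2 * \<kappa> powr r) * (\<Sum>\<^sub>\<infinity>i\<in>I. \<integral>\<^sup>+\<omega>. ennreal (\<bar>X i \<omega>\<bar> * ((min \<bar>X i \<omega>\<bar> t / t) powr r) powr (1 - 1 / r)) \<partial>M)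
      \<le> (\<integral>\<^sup>+\<omega>. weighted_norm \<omega> \<partial>M)"
    by (intro test_function_lower_bound[where h="\<lambda>_ x. (min \<bar>x\<bar> t / t) powr r"] scaled_truncation_bounds t)
  also have "(\<Sum>\<^sub>\<infinity>i\<in>I. \<integral>\<^sup>+\<omega>. ennreal (\<bar>X i \<omega>\<bar> * ((min \<bar>X i \<omega>\<bar> t / t) powr r) powr (1 - 1 / r)) \<partial>M)
    = (\<Sum>\<^sub>\<infinity>i\<in>I. ennreal (t powr (1 - r)) * (\<integral>\<^sup>+\<omega>. ennreal ((min \<bar>X i \<omega>\<bar> t) powr r) \<partial>M) + (\<integral>\<^sup>+\<omega>. ennreal (max (\<bar>X i \<omega>\<bar> - t) 0) \<partial>M))"
    unfolding truncation_identity[OF t r]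
    by (intro infsum_cong) (simp add: nn_integral_add nn_integral_cmult ennreal_mult)
  also have "\<dots> = ennreal (t powr (1 - r)) * truncated_moment t + excess t"
    by (simp add: infsum_add nonneg_summable_on_complete infsum_cmult_ennreal)
  finally show ?thesis .
qed

text \<open>
  If the test functions at level \<open>t\<close> have total mass more than 1, normalising them on a suitable finite set of indices to total
  mass 1 makes them admissible. They satisfy \<open>t h(x) \<le> \<bar>x\<bar> h(x)\<^sup>a\<close> with \<open>a = 1 - 1 / r\<close>, and summing the means
  of \<open>t h\<^sub>i(X\<^sub>i)\<close> gives \<open>t\<close>: the level itself becomes a lower bound.
\<close>

lemma level_lower_bound:
  assumes t: "0 < t" and moment_gt: "ennreal (t powr r) < truncated_moment t"
  shows "ennreal (1 / 2 * \<kappa> powr r) * ennreal t \<le> (\<integral>\<^sup>+\<omega>. weighted_norm \<omega> \<partial>M)"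
proof -
  define c where "c = ennreal (1 / 2 * \<kappa> powr r)"
  let ?h = "\<lambda>x. (min \<bar>x\<bar> t / t) powr r"
  note h = scaled_truncation_bounds[OF t]
  obtain F where F: "finite F" "F \<subseteq> I" and gt: "ennreal (t powr r) < (\<Sum>i\<in>F. \<integral>\<^sup>+\<omega>. ennreal ((min \<bar>X i \<omega>\<bar> t) powr r) \<partial>M)"
    using moment_gt by (auto simp: nonneg_infsum_complete less_SUP_iff)
  define p where "p = (\<lambda>i. expectation (\<lambda>\<omega>. ?h (X i \<omega>)))"
  define P where "P = sum p F"
  have int_h: "integrable M (\<lambda>\<omega>. ?h (X i \<omega>))" if "i \<in> F" for i
    using h that F X[of i] by (intro integrable_const_bound[where B=1]) auto
  have nn_h: "(\<integral>\<^sup>+\<omega>. ennreal (?h (X i \<omega>)) \<partial>M) = ennreal (p i)" if "i \<in> F" for i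
    unfolding p_def using int_h[OF that] by (intro nn_integral_eq_integral) auto
  have p0: "0 \<le> p i" for i
    unfolding p_def by (intro integral_nonneg_AE) auto
  have P1: "1 < P"
  proof -
    have "ennreal (t powr -r) * ennreal (t powr r) < ennreal (t powr -r) * (\<Sum>i\<in>F. \<integral>\<^sup>+\<omega>. ennreal ((min \<bar>X i \<omega>\<bar> t) powr r) \<partial>M)"
      using gt t by (intro ennreal_mult_strict_left_mono) auto
    also have "\<dots> = (\<Sum>i\<in>F. ennreal (p i))"
      unfolding sum_distrib_left using F t by (intro sum.cong) (auto simp: scaled_truncated_moment[symmetric] nn_h)
    also have "\<dots> = ennreal P"
      using p0 by (simp add: P_def)
    finally show ?thesis
      using t by (simp add: ennreal_mult[symmetric] powr_add[symmetric])
  qed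
  let ?g = "\<lambda>x. ?h x / P"
  have g: "?g \<in> borel_measurable borel" "0 \<le> ?g x" "?g x \<le> 1" for x
    using h P1 order_trans[OF h(3)[of x], of P] by (auto simp: divide_le_eq)
  have nn_g: "(\<integral>\<^sup>+\<omega>. ennreal (?g (X i \<omega>)) \<partial>M) = ennreal (p i / P)" if "i \<in> F" for i
    using int_h[OF that] P1 by (subst nn_integral_eq_integral) (auto simp: p_def)
  have sum_g: "(\<Sum>i\<in>F. \<integral>\<^sup>+\<omega>. ennreal (?g (X i \<omega>)) \<partial>M) = 1"
  proof -
    have "(\<Sum>i\<in>F. \<integral>\<^sup>+\<omega>. ennreal (?g (X i \<omega>)) \<partial>M) = ennreal (\<Sum>i\<in>F. p i / P)"
      using p0 P1 by (simp add: nn_g)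
    also have "(\<Sum>i\<in>F. p i / P) = 1"
      using P1 by (simp add: P_def sum_divide_distrib[symmetric])
    finally show ?thesis
      by simp
  qed
  \<comment> \<open>Without the normalisation, \<open>t * ?h x powr (1 / r)\<close> is \<open>min \<bar>x\<bar> t\<close>; dividing by \<open>P > 1\<close> only lowers it.\<close>
  have pointwise: "t * ?g x \<le> \<bar>x\<bar> * ?g x powr (1 - 1 / r)" for x
  proof -
    have "t * ?g x powr (1 / r) \<le> t * ?h x powr (1 / r)"
      using t r P1 mult_left_mono[of 1 P "?h x"] by (intro mult_left_mono powr_mono2) (auto simp: divide_le_eq)
    also have "\<dots> = min \<bar>x\<bar> t"
      using t r by (simp add: powr_powr)
    finally have "t * ?g x powr (1 / r) * ?g x powr (1 - 1 / r) \<le> \<bar>x\<bar> * ?g x powr (1 - 1 / r)"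
      by (intro mult_right_mono) auto
    then show ?thesis
      using g(2)[of x] P1 by (simp add: mult.assoc powr_add[symmetric])
  qed
  have "c * ennreal t = c * (\<Sum>i\<in>F. \<integral>\<^sup>+\<omega>. ennreal (t * ?g (X i \<omega>)) \<partial>M)"
  proof -
    have "(\<Sum>i\<in>F. \<integral>\<^sup>+\<omega>. ennreal (t * ?g (X i \<omega>)) \<partial>M) = (\<Sum>i\<in>F. ennreal t * (\<integral>\<^sup>+\<omega>. ennreal (?g (X i \<omega>)) \<partial>M))"
      using F t P1 X by (intro sum.cong refl) (subst nn_integral_cmult[symmetric], auto simp: ennreal_mult[symmetric])
    then show ?thesis
      by (simp add: sum_distrib_left[symmetric] sum_g)
  qed
  also have "\<dots> \<le> c * (\<Sum>i\<in>F. \<integral>\<^sup>+\<omega>. ennreal (\<bar>X i \<omega>\<bar> * ?g (X i \<omega>) powr (1 - 1 / r)) \<partial>M)"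
    by (intro mult_left_mono sum_mono nn_integral_mono ennreal_leI pointwise) simp
  also have "\<dots> \<le> (\<integral>\<^sup>+\<omega>. weighted_norm \<omega> \<partial>M)"
    unfolding c_def
  proof (rule finite_test_function_lower_bound[where h="\<lambda>_. ?g", OF F g])
    have "(\<Sum>i\<in>F. expectation (\<lambda>\<omega>. ?g (X i \<omega>))) = P / P"
      unfolding P_def sum_divide_distrib by (simp add: p_def)
    then show "(\<Sum>i\<in>F. expectation (\<lambda>\<omega>. ?g (X i \<omega>))) \<le> 1"
      using P1 by simp
  qed
  finally show ?thesis
    unfolding c_def .
qed

text \<open>
  The decomposition truncates each variable to \<open>[-t, t]\<close>. This soft cut, rather than the restriction to
  \<open>{\<bar>X\<^sub>i\<bar> \<le> t}\<close>, is the one whose cost matches the lower bound.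
\<close>

lemma truncation_upper_bound:
  assumes t: "0 < t"
  shows "(INF (Y, Z) \<in> decompositions M I X.
         enn_powr (\<Sum>\<^sub>\<infinity>i\<in>I. \<integral>\<^sup>+\<omega>. ennreal (\<bar>Y i \<omega>\<bar> powr r) \<partial>M) (1 / r)
         + (\<Sum>\<^sub>\<infinity>i\<in>I. \<integral>\<^sup>+\<omega>. ennreal \<bar>Z i \<omega>\<bar> \<partial>M))
    \<le> enn_powr (truncated_moment t) (1 / r) + excess t" (is "?INF \<le> _")
proof -
  let ?Y = "\<lambda>i \<omega>. max (- t) (min (X i \<omega>) t)"
  let ?Z = "\<lambda>i \<omega>. X i \<omega> - ?Y i \<omega>"
  have "(?Y, ?Z) \<in> decompositions M I X"
    by (auto simp: decompositions_def)
  then have "?INF \<le> enn_powr (\<Sum>\<^sub>\<infinity>i\<in>I. \<integral>\<^sup>+\<omega>. ennreal (\<bar>?Y i \<omega>\<bar> powr r) \<partial>M) (1 / r)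
       + (\<Sum>\<^sub>\<infinity>i\<in>I. \<integral>\<^sup>+\<omega>. ennreal \<bar>?Z i \<omega>\<bar> \<partial>M)"
    by (rule INF_lower2) simp
  moreover have "\<bar>?Y i \<omega>\<bar> = min \<bar>X i \<omega>\<bar> t" "\<bar>?Z i \<omega>\<bar> = max (\<bar>X i \<omega>\<bar> - t) 0" for i \<omega>
    using t by (auto simp: min_def max_def abs_if)
  ultimately show ?thesis
    by (simp only:)
qed

end

section \<open>Choice of the level\<close>

theorem theorem1:
  fixes M :: "'a measure" and I :: "'i set"
    and X W :: "'i \<Rightarrow> 'a \<Rightarrow> real" and r \<kappa> :: real
  assumes "prob_space M"
    and "1 \<le> r"
    and "0 < \<kappa>"
    and "countable I"
    and "prob_space.indep_vars M (\<lambda>_. borel) X I"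
    and "\<And>i. i \<in> I \<Longrightarrow> W i \<in> borel_measurable M"
    and "\<And>i \<omega>. i \<in> I \<Longrightarrow> \<omega> \<in> space M \<Longrightarrow> W i \<omega> \<in> {0..1}"
    and "\<And>i. i \<in> I \<Longrightarrow>
      AE \<omega> in M. \<kappa> \<le> real_cond_exp M (vimage_algebra (space M) (X i) borel) (W i) \<omega>"
  shows "(\<integral>\<^sup>+\<omega>. enn_powr (\<Sum>\<^sub>\<infinity>i\<in>I. ennreal (\<bar>W i \<omega> * X i \<omega>\<bar> powr r)) (1 / r) \<partial>M)
    \<ge> ennreal (1 / 2 * \<kappa> powr r) *
      (INF (Y, Z) \<in> decompositions M I X.
         enn_powr (\<Sum>\<^sub>\<infinity>i\<in>I. \<integral>\<^sup>+\<omega>. ennreal (\<bar>Y i \<omega>\<bar> powr r) \<partial>M) (1 / r)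
         + (\<Sum>\<^sub>\<infinity>i\<in>I. \<integral>\<^sup>+\<omega>. ennreal \<bar>Z i \<omega>\<bar> \<partial>M))"
    (is "_ * ?INF \<le> ?L")
proof -
  interpret weighted_independent_family M I X W r \<kappa>
    by (intro weighted_independent_family.intro weighted_independent_family_axioms.intro) fact+
  define c where "c = ennreal (1 / 2 * \<kappa> powr r)"
  define \<Phi> where "\<Phi> = (\<lambda>t. truncated_moment t)"
  define B where "B = (\<lambda>t. excess t)"
  have upper: "?INF \<le> enn_powr (\<Phi> t) (1 / r) + B t" if "0 < t" for t
    unfolding \<Phi>_def B_def using that by (rule truncation_upper_bound)
  have low: "c * (ennreal (t powr (1 - r)) * \<Phi> t + B t) \<le> ?L" if "0 < t" "\<Phi> t \<le> ennreal (t powr r)" for t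
    using truncation_lower_bound that by (simp only: c_def \<Phi>_def B_def)
  have level: "c * ennreal t \<le> ?L" if "0 < t" "ennreal (t powr r) < \<Phi> t" for t
    using level_lower_bound that by (simp only: c_def \<Phi>_def)
  show ?thesis
  proof (cases "\<exists>t>0. \<Phi> t \<le> ennreal (t powr r)")
    case False
    \<comment> \<open>No level is admissible, so \<open>level\<close> applies to all \<open>t > 0\<close>.\<close>
    have "?L = \<infinity>"
    proof (rule ccontr)
      assume "?L \<noteq> \<infinity>"
      then obtain l where l: "?L = ennreal l" "0 \<le> l"
        by (cases ?L) auto
      define k where "k = 1 / 2 * \<kappa> powr r"
      have k: "0 < k"
        using \<kappa> by (simp add: k_def)
      have "c * ennreal ((l + 1) / k) \<le> ennreal l"
        using False k l by (subst l(1)[symmetric], intro level) (auto simp: not_le)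
      moreover have "c * ennreal ((l + 1) / k) = ennreal (l + 1)"
        unfolding c_def k_def[symmetric] using k l by (subst ennreal_mult[symmetric]) auto
      ultimately show False
        using l by simp
    qed
    then show ?thesis
      by simp
  next
    case True
    define T where "T = {t. 0 < t \<and> \<Phi> t \<le> ennreal (t powr r)}"
    define t0 where "t0 = Inf T"
    have T: "T \<noteq> {}" "bdd_below T"
      using True by (auto simp: T_def intro!: bdd_belowI[of _ 0])
    have t0: "0 \<le> t0"
      unfolding t0_def using T by (intro cInf_greatest) (auto simp: T_def)
    have near: "\<exists>t\<in>T. t < t0 + \<epsilon>" if "0 < \<epsilon>" for \<epsilon>
      using cInf_lessD[OF T(1), of "t0 + \<epsilon>"] that by (auto simp: t0_def)
    show ?thesis
    proof (cases "t0 = 0")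
      \<comment> \<open>Truncating at a small admissible level \<open>t\<close> costs at most \<open>t\<close> more than the lower bound.\<close>
      case True
      have "c * ?INF \<le> ?L + ennreal \<epsilon>" if \<epsilon>: "0 < \<epsilon>" for \<epsilon>
      proof -
        define k where "k = 1 / 2 * \<kappa> powr r"
        have k: "0 < k"
          using \<kappa> by (simp add: k_def)
        obtain t where t: "0 < t" "\<Phi> t \<le> ennreal (t powr r)" "t < \<epsilon> / k"
          using near[of "\<epsilon> / k"] \<epsilon> k True by (auto simp: T_def)
        have "enn_powr (\<Phi> t) (1 / r) \<le> enn_powr (ennreal (t powr r)) (1 / r)"
          using t r by (intro enn_powr_mono) auto
        also have "\<dots> = ennreal t"
          using t r by (simp add: enn_powr_ennreal powr_powr)
        finally have "?INF \<le> ennreal t + (ennreal (t powr (1 - r)) * \<Phi> t + B t)"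
          using upper[OF t(1)] by (meson add_mono add_increasing order_refl order_trans zero_le)
        then have "c * ?INF \<le> c * ennreal t + c * (ennreal (t powr (1 - r)) * \<Phi> t + B t)"
          unfolding distrib_left[symmetric] by (rule mult_left_mono) simp
        also have "\<dots> \<le> ennreal \<epsilon> + ?L"
        proof (rule add_mono)
          show "c * ennreal t \<le> ennreal \<epsilon>"
            unfolding c_def k_def[symmetric] using t k
            by (subst ennreal_mult[symmetric]) (auto intro!: ennreal_leI simp: field_simps)
        qed (rule low[OF t(1,2)])
        finally show ?thesis
          by (simp add: add.commute)
      qed
      then show ?thesis
        unfolding c_def by (rule ennreal_le_epsilon)
    next
      case False
      with t0 have t0: "0 < t0"
        by simp
      have \<Phi>0: "\<Phi> t0 = ennreal (t0 powr r)"
        unfolding t0_def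
        by (rule mono_eq_powr_at_first_crossing[OF _ T_def T(1)])
          (use truncated_moment_mono t0 in \<open>auto simp: \<Phi>_def t0_def\<close>)
      have "enn_powr (\<Phi> t0) (1 / r) = ennreal (t0 powr (1 - r)) * \<Phi> t0"
        unfolding \<Phi>0 using t0 r
        by (simp add: enn_powr_ennreal powr_powr ennreal_mult[symmetric] powr_add[symmetric])
      then have "c * ?INF \<le> c * (ennreal (t0 powr (1 - r)) * \<Phi> t0 + B t0)"
        using upper[OF t0] by (auto intro: mult_left_mono)
      also have "\<dots> \<le> ?L"
        using t0 \<Phi>0 by (intro low) auto
      finally show ?thesis
        unfolding c_def .
    qed
  qed
qed

end
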